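(* Let $\varphi$ be a formula of $\mathcal R\text{Ł}$. There exists a sequence of rational formulas $\Theta=\{\varphi_n\}_{n\in\mathbb N}\subseteq Form_{\mathcal QL}$ such that $Thm(\varphi,\mathcal R\text{Ł}^* )=Thm(\Theta,\mathcal R\text{Ł}^* )$.
   Context: The logic $\mathcal R\text{Ł}$: formulas are built from propositional variables $v_1,v_2,\dots$ with connectives $\neg$, $\rightarrow$ and unary connectives $\nabla_r$, $r\in[0,1]$. Abbreviations: $\varphi\vee\psi=(\varphi\to\psi)\to\psi$, $\varphi\&\psi=\neg(\varphi\to\neg\psi)$, $\varphi\leftrightarrow\psi=(\varphi\to\psi)\&(\psi\to\varphi)$, $\Delta_r\varphi=\neg\nabla_r\neg\varphi$. For reals $r,q\in[0,1]$, $r\odot q^*=\max(0,r-q)$. Axioms: (L1) $\varphi\to(\psi\to\varphi)$; (L2) $(\varphi\to\psi)\to((\psi\to\chi)\to(\varphi\to\chi))$; (L3) $(\varphi\vee\psi)\to(\psi\vee\varphi)$; (L4) $(\neg\psi\to\neg\varphi)\to(\varphi\to\psi)$; (R1) $\nabla_r(\varphi\to\psi)\leftrightarrow(\nabla_r\varphi\to\nabla_r\psi)$; (R2) $\nabla_{r\odot q^*}\varphi\leftrightarrow(\nabla_q\varphi\to\nabla_r\varphi)$; (R3) $\nabla_r(\nabla_q\varphi)\leftrightarrow\nabla_{rq}\varphi$; (R4) $\nabla_1\varphi\leftrightarrow\varphi$. The only rule is modus ponens. $Form_{\mathcal QL}$ is the set of rational formulas, i.e. formulas in which every connective $\nabla_q$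 occurring has $q\in[0,1]\cap\mathbb Q$. The term function $f_\varphi$ maps a $[0,1]$-valued assignment to the variables to the value of $\varphi$ when $\neg$, $\to$, $\nabla_r$ are interpreted in $[0,1]$ by $1-x$, $\min(1,1-x+y)$, $1-r(1-x)$. One writes $\varphi=\lim_m\varphi_m$ if $(f_{\varphi_m})_m$ converges uniformly to $f_\varphi$ (equivalently: for a fixed theorem $\eta$ of $\mathcal R\text{Ł}$, for every $r\in[0,1)$ there is $k$ such that $\Delta_r\eta\to(\varphi\leftrightarrow\varphi_m)$ is a theorem of $\mathcal R\text{Ł}$ for all $m\ge k$). $\mathcal R\text{Ł}^*$ is the logic obtained from $\mathcal R\text{Ł}$ by adding the infinitary deduction rule ($\star$): if $\varphi=\lim_m\varphi_m$, then from $\varphi_1,\varphi_2,\dots,\varphi_m,\dots$ infer $\varphi$. For a set $\Theta$ of formulas, $Thm(\Theta,\mathcal R\text{Ł}^* )$ is the set of formulas derivable from $\Theta$ in $\mathcal R\text{Ł}^*$, i.e. the smallest set of formulas containing $\Theta$ and the axioms and closed under modus ponens and ($\star$); $Thm(\varphi,\cdot)=Thm(\{\varphi\},\cdot)$. *)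

theory Defs
  imports "HOL-Analysis.Analysis"
begin

typedef unit_real = "{0..1::real}" morphisms real_of_unit unit_of_real
  by (rule exI[of _ 0]) simp

setup_lifting type_definition_unit_real

lift_definition unit_one :: unit_real is 1 by simp

lift_definition unit_mult :: "unit_real \<Rightarrow> unit_real \<Rightarrow> unit_real" is "\<lambda>r q. r * q"
  by (simp add: mult_le_one)

text \<open>\<open>unit_diff r q\<close> is \<open>r \<odot> q\<^sup>*\<close>.\<close>

lift_definition unit_diff :: "unit_real \<Rightarrow> unit_real \<Rightarrow> unit_real" is "\<lambda>r q. max 0 (r - q)"
  by auto

text \<open>The variables are numbered from 0.\<close>

datatype form =
    Var nat
  | Neg form
  | Imp form form
  | Nabla unit_real form

definition Disj :: "form \<Rightarrow> form \<Rightarrow> form" where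
  "Disj \<phi> \<psi> = Imp (Imp \<phi> \<psi>) \<psi>"

definition Conj :: "form \<Rightarrow> form \<Rightarrow> form" where
  "Conj \<phi> \<psi> = Neg (Imp \<phi> (Neg \<psi>))"

definition Iff :: "form \<Rightarrow> form \<Rightarrow> form" where
  "Iff \<phi> \<psi> = Conj (Imp \<phi> \<psi>) (Imp \<psi> \<phi>)"

inductive_set axioms_RL :: "form set" where
  L1: "Imp \<phi> (Imp \<psi> \<phi>) \<in> axioms_RL"
| L2: "Imp (Imp \<phi> \<psi>) (Imp (Imp \<psi> \<xi>) (Imp \<phi> \<xi>)) \<in> axioms_RL"
| L3: "Imp (Disj \<phi> \<psi>) (Disj \<psi> \<phi>) \<in> axioms_RL"
| L4: "Imp (Imp (Neg \<psi>) (Neg \<phi>)) (Imp \<phi> \<psi>) \<in> axioms_RL"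
| R1: "Iff (Nabla r (Imp \<phi> \<psi>)) (Imp (Nabla r \<phi>) (Nabla r \<psi>)) \<in> axioms_RL"
| R2: "Iff (Nabla (unit_diff r q) \<phi>) (Imp (Nabla q \<phi>) (Nabla r \<phi>)) \<in> axioms_RL"
| R3: "Iff (Nabla r (Nabla q \<phi>)) (Nabla (unit_mult r q) \<phi>) \<in> axioms_RL"
| R4: "Iff (Nabla unit_one \<phi>) \<phi> \<in> axioms_RL"

primrec rational_form :: "form \<Rightarrow> bool" where
  "rational_form (Var n) \<longleftrightarrow> True"
| "rational_form (Neg \<phi>) \<longleftrightarrow> rational_form \<phi>"
| "rational_form (Imp \<phi> \<psi>) \<longleftrightarrow> rational_form \<phi> \<and> rational_form \<psi>"
| "rational_form (Nabla q \<phi>) \<longleftrightarrow> real_of_unit q \<in> \<rat> \<and> rational_form \<phi>"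

definition Form_QL :: "form set" where
  "Form_QL = {\<phi>. rational_form \<phi>}"

primrec term_fun :: "form \<Rightarrow> (nat \<Rightarrow> real) \<Rightarrow> real" where
  "term_fun (Var n) e = e n"
| "term_fun (Neg \<phi>) e = 1 - term_fun \<phi> e"
| "term_fun (Imp \<phi> \<psi>) e = min 1 (1 - term_fun \<phi> e + term_fun \<psi> e)"
| "term_fun (Nabla r \<phi>) e = 1 - real_of_unit r * (1 - term_fun \<phi> e)"

definition form_lim :: "(nat \<Rightarrow> form) \<Rightarrow> form \<Rightarrow> bool" where
  "form_lim \<Phi> \<phi> \<longleftrightarrow>
     uniform_limit {e. \<forall>n. e n \<in> {0..1}} (\<lambda>m. term_fun (\<Phi> m)) (term_fun \<phi>) sequentially"

inductive_set Thm_RL_star :: "form set \<Rightarrow> form set" for \<Theta> :: "form set" where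
  hyp: "\<phi> \<in> \<Theta> \<Longrightarrow> \<phi> \<in> Thm_RL_star \<Theta>"
| ax: "\<phi> \<in> axioms_RL \<Longrightarrow> \<phi> \<in> Thm_RL_star \<Theta>"
| mp: "\<phi> \<in> Thm_RL_star \<Theta> \<Longrightarrow> Imp \<phi> \<psi> \<in> Thm_RL_star \<Theta> \<Longrightarrow> \<psi> \<in> Thm_RL_star \<Theta>"
| star: "form_lim \<Phi> \<phi> \<Longrightarrow> (\<And>m. \<Phi> m \<in> Thm_RL_star \<Theta>) \<Longrightarrow> \<phi> \<in> Thm_RL_star \<Theta>"

end

theory Submission
  imports Defs
begin

text \<open>
  Since \<open>\<rightarrow>\<close>, \<open>\<not>\<close> and \<open>\<nabla>\<^sub>r\<close> are monotone or antitone in each argument and antitone in \<open>r\<close>, a formula can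
  be squeezed between rational formulas by rounding its coefficients up or down according to polarity.
  If \<open>\<phi>\<^sub>n\<close> are such upper approximations of \<open>\<phi>\<close>, then \<open>\<phi> \<rightarrow> \<phi>\<^sub>n\<close> is a tautology, so \<open>\<phi>\<close> derives
  every \<open>\<phi>\<^sub>n\<close>; conversely \<open>\<phi>\<close> follows from the \<open>\<phi>\<^sub>n\<close> by the rule (\<open>\<star>\<close>). Completeness for tautologies
  is immediate here: a tautology is the limit of the constant sequence at any axiom.
\<close>

abbreviation assignments :: "(nat \<Rightarrow> real) set" where
  "assignments \<equiv> {e. \<forall>n. e n \<in> {0..1}}"

lemma real_of_unit_bounds: "0 \<le> real_of_unit r" "real_of_unit r \<le> 1"
  using real_of_unit[of r] by auto

lemma term_fun_bounds:
  assumes "e \<in> assignments"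
  shows "0 \<le> term_fun \<phi> e \<and> term_fun \<phi> e \<le> 1"
proof (induction \<phi>)
  case (Nabla r \<phi>)
  then show ?case
    using mult_le_one[of "real_of_unit r" "1 - term_fun \<phi> e"] real_of_unit_bounds[of r] by simp
qed (use assms in auto)

lemma tautology_in_Thm:
  assumes "\<And>e. e \<in> assignments \<Longrightarrow> term_fun \<phi> e = 1"
  shows "\<phi> \<in> Thm_RL_star \<Theta>"
proof -
  \<comment> \<open>An instance of \<open>L1\<close>, whose value is 1 whenever \<open>e 0\<close>
    lies in [0,1]. Since \<open>form_lim\<close> compares values on assignments only, its constant
    sequence converges to any tautology.\<close>
  let ?\<eta> = "Imp (Var 0) (Imp (Var 0) (Var 0))"
  have "term_fun ?\<eta> e = term_fun \<phi> e" if "e \<in> assignments" for e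
    using assms[OF that] that by simp
  then have "form_lim (\<lambda>_. ?\<eta>) \<phi>"
    unfolding form_lim_def by (intro uniform_limitI) simp
  then show ?thesis
    by (rule Thm_RL_star.star) (rule Thm_RL_star.ax[OF axioms_RL.L1])
qed

lemma Thm_closed:
  assumes "\<Theta> \<subseteq> Thm_RL_star \<Theta>'"
  shows "Thm_RL_star \<Theta> \<subseteq> Thm_RL_star \<Theta>'"
proof
  fix \<psi>
  assume "\<psi> \<in> Thm_RL_star \<Theta>"
  then show "\<psi> \<in> Thm_RL_star \<Theta>'"
    by induction (use assms in \<open>auto intro: Thm_RL_star.intros\<close>)
qed

lemma rational_below:
  fixes r :: unit_real
  assumes "\<epsilon> > 0"
  obtains q where "real_of_unit q \<in> \<rat>" "real_of_unit q \<le> real_of_unit r"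
    "real_of_unit r \<le> real_of_unit q + \<epsilon>"
proof -
  define x where "x = real_of_unit r"
  have x: "0 \<le> x" "x \<le> 1"
    using real_of_unit_bounds by (auto simp: x_def)
  have "\<exists>q\<in>\<rat>. 0 \<le> q \<and> q \<le> x \<and> x \<le> q + \<epsilon>"
  \<comment> \<open>Density supplies a rational strictly between
    \<open>max 0 (x - \<epsilon>)\<close> and \<open>x\<close>. That interval is empty exactly when
    \<open>x = 0\<close>, where 0 itself serves.\<close>
  proof (cases "x = 0")
    case True
    then show ?thesis using assms by (intro bexI[of _ 0]) auto
  next
    case False
    then have "max 0 (x - \<epsilon>) < x" using x assms by auto
    from Rats_dense_in_real[OF this] show ?thesis by force
  qed
  then obtain q where "q \<in> \<rat>" "0 \<le> q" "q \<le> x" "x \<le> q + \<epsilon>" by blast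
  then show thesis
    using that[of "unit_of_real q"] x by (simp add: x_def unit_of_real_inverse)
qed

lemma rational_above:
  fixes r :: unit_real
  assumes "\<epsilon> > 0"
  obtains q where "real_of_unit q \<in> \<rat>" "real_of_unit r \<le> real_of_unit q"
    "real_of_unit q \<le> real_of_unit r + \<epsilon>"
proof -
  \<comment> \<open>The reflection of [0,1] that sends r to 1 - r reverses the order and preserves
    rationality, so this case reduces to \<open>rational_below\<close>.\<close>
  have "real_of_unit (unit_of_real (1 - real_of_unit r)) = 1 - real_of_unit r"
    using real_of_unit_bounds[of r] by (simp add: unit_of_real_inverse)
  then obtain p where p: "real_of_unit p \<in> \<rat>" "real_of_unit p \<le> 1 - real_of_unit r"
    "1 - real_of_unit r \<le> real_of_unit p + \<epsilon>"
    using rational_below[OF assms, of "unit_of_real (1 - real_of_unit r)"] by metis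
  have "real_of_unit (unit_of_real (1 - real_of_unit p)) = 1 - real_of_unit p"
    using real_of_unit_bounds[of p] by (simp add: unit_of_real_inverse)
  then show thesis
    using that[of "unit_of_real (1 - real_of_unit p)"] p by simp
qed

text \<open>The gap r(1 - x) - q(1 - y) splits as (r - q)(1 - x) + q(y - x). The factors 1 - x and q
  are at most 1, so the errors in the coefficient and in the argument simply add.\<close>

lemma nabla_mono:
  fixes q r x y \<delta> \<epsilon> :: real
  assumes "0 \<le> q" "q \<le> r" "r \<le> 1" "r \<le> q + \<delta>" "0 \<le> x" "x \<le> y" "y \<le> 1" "y \<le> x + \<epsilon>"
  shows "1 - r * (1 - x) \<le> 1 - q * (1 - y)" "1 - q * (1 - y) \<le> 1 - r * (1 - x) + (\<delta> + \<epsilon>)"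
proof -
  show "1 - r * (1 - x) \<le> 1 - q * (1 - y)"
    using mult_mono[of q r "1 - y" "1 - x"] assms by simp
  have "(r - q) * (1 - x) \<le> \<delta> * 1"
    using assms by (intro mult_mono) auto
  moreover have "q * (y - x) \<le> 1 * \<epsilon>"
    using assms by (intro mult_mono) auto
  ultimately show "1 - q * (1 - y) \<le> 1 - r * (1 - x) + (\<delta> + \<epsilon>)"
    by (simp add: algebra_simps)
qed

text \<open>Lower and upper approximations are built together because \<open>Neg\<close> and the
  left argument of \<open>Imp\<close> exchange their roles. The tolerance varies in the induction so
  that it can be halved wherever two errors add.\<close>

lemma rational_squeeze:
  assumes "\<epsilon> > 0"
  shows "\<exists>\<alpha>\<in>Form_QL. \<exists>\<beta>\<in>Form_QL. \<forall>e\<in>assignments.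
    term_fun \<alpha> e \<le> term_fun \<phi> e \<and> term_fun \<phi> e \<le> term_fun \<alpha> e + \<epsilon> \<and>
    term_fun \<phi> e \<le> term_fun \<beta> e \<and> term_fun \<beta> e \<le> term_fun \<phi> e + \<epsilon>"
  using assms
proof (induction \<phi> arbitrary: \<epsilon>)
  case (Var n)
  then show ?case
    by (intro bexI[of _ "Var n"]) (auto simp: Form_QL_def)
next
  case (Neg \<phi>)
  from Neg.IH[OF Neg.prems] obtain \<alpha> \<beta> where "\<alpha> \<in> Form_QL" "\<beta> \<in> Form_QL"
    "\<forall>e\<in>assignments. term_fun \<alpha> e \<le> term_fun \<phi> e \<and> term_fun \<phi> e \<le> term_fun \<alpha> e + \<epsilon> \<and>
      term_fun \<phi> e \<le> term_fun \<beta> e \<and> term_fun \<beta> e \<le> term_fun \<phi> e + \<epsilon>"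
    by blast
  then show ?case
    by (intro bexI[of _ "Neg \<beta>", OF bexI[of _ "Neg \<alpha>"]]) (auto simp: Form_QL_def algebra_simps)
next
  case (Imp \<phi> \<psi>)
  have half: "\<epsilon> / 2 > 0" using Imp.prems by simp
  from Imp.IH(1)[OF half] obtain \<alpha> \<beta> where a: "\<alpha> \<in> Form_QL" "\<beta> \<in> Form_QL"
    "\<forall>e\<in>assignments. term_fun \<alpha> e \<le> term_fun \<phi> e \<and> term_fun \<phi> e \<le> term_fun \<alpha> e + \<epsilon> / 2 \<and>
      term_fun \<phi> e \<le> term_fun \<beta> e \<and> term_fun \<beta> e \<le> term_fun \<phi> e + \<epsilon> / 2"
    by blast
  from Imp.IH(2)[OF half] obtain \<alpha>' \<beta>' where b: "\<alpha>' \<in> Form_QL" "\<beta>' \<in> Form_QL"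
    "\<forall>e\<in>assignments. term_fun \<alpha>' e \<le> term_fun \<psi> e \<and> term_fun \<psi> e \<le> term_fun \<alpha>' e + \<epsilon> / 2 \<and>
      term_fun \<psi> e \<le> term_fun \<beta>' e \<and> term_fun \<beta>' e \<le> term_fun \<psi> e + \<epsilon> / 2"
    by blast
  \<comment> \<open>The antecedent is antitone: a lower bound pairs \<beta> with \<alpha>', an upper
    bound \<alpha> with \<beta>'. Truncation at 1 does not enlarge the sum of the two
    errors.\<close>
  show ?case
  proof (rule bexI[of _ "Imp \<beta> \<alpha>'", OF bexI[of _ "Imp \<alpha> \<beta>'", OF ballI]])
    fix e assume "e \<in> assignments"
    from a(3)[rule_format, OF this] b(3)[rule_format, OF this]
    show "term_fun (Imp \<beta> \<alpha>') e \<le> term_fun (Imp \<phi> \<psi>) e \<and>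
      term_fun (Imp \<phi> \<psi>) e \<le> term_fun (Imp \<beta> \<alpha>') e + \<epsilon> \<and>
      term_fun (Imp \<phi> \<psi>) e \<le> term_fun (Imp \<alpha> \<beta>') e \<and>
      term_fun (Imp \<alpha> \<beta>') e \<le> term_fun (Imp \<phi> \<psi>) e + \<epsilon>"
      using half unfolding term_fun.simps by (intro conjI; linarith)
  qed (use a b in \<open>auto simp: Form_QL_def\<close>)
next
  case (Nabla r \<phi>)
  have half: "\<epsilon> / 2 > 0" using Nabla.prems by simp
  from Nabla.IH[OF half] obtain \<alpha> \<beta> where a: "\<alpha> \<in> Form_QL" "\<beta> \<in> Form_QL"
    "\<forall>e\<in>assignments. term_fun \<alpha> e \<le> term_fun \<phi> e \<and> term_fun \<phi> e \<le> term_fun \<alpha> e + \<epsilon> / 2 \<and>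
      term_fun \<phi> e \<le> term_fun \<beta> e \<and> term_fun \<beta> e \<le> term_fun \<phi> e + \<epsilon> / 2"
    by blast
  obtain p where p: "real_of_unit p \<in> \<rat>" "real_of_unit p \<le> real_of_unit r"
    "real_of_unit r \<le> real_of_unit p + \<epsilon> / 2"
    using rational_below[OF half] .
  obtain q where q: "real_of_unit q \<in> \<rat>" "real_of_unit r \<le> real_of_unit q"
    "real_of_unit q \<le> real_of_unit r + \<epsilon> / 2"
    using rational_above[OF half] .
  \<comment> \<open>The value 1 - r(1 - x) decreases in r and increases in x, so the lower bound
    takes the larger coefficient q, the upper bound the smaller p.\<close>
  show ?case
  proof (rule bexI[of _ "Nabla q \<alpha>", OF bexI[of _ "Nabla p \<beta>", OF ballI]])
    fix e assume e: "e \<in> assignments"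
    note bounds = a(3)[rule_format, OF e] term_fun_bounds[OF e] real_of_unit_bounds
    show "term_fun (Nabla q \<alpha>) e \<le> term_fun (Nabla r \<phi>) e \<and>
      term_fun (Nabla r \<phi>) e \<le> term_fun (Nabla q \<alpha>) e + \<epsilon> \<and>
      term_fun (Nabla r \<phi>) e \<le> term_fun (Nabla p \<beta>) e \<and>
      term_fun (Nabla p \<beta>) e \<le> term_fun (Nabla r \<phi>) e + \<epsilon>"
      using nabla_mono[of "real_of_unit r" "real_of_unit q" "\<epsilon> / 2" "term_fun \<alpha> e" "term_fun \<phi> e" "\<epsilon> / 2"]
        nabla_mono[of "real_of_unit p" "real_of_unit r" "\<epsilon> / 2" "term_fun \<phi> e" "term_fun \<beta> e" "\<epsilon> / 2"]
        bounds p q by simp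
  qed (use a p q in \<open>auto simp: Form_QL_def\<close>)
qed

theorem proposition3p24:
  fixes \<phi> :: form
  shows "\<exists>\<Phi> :: nat \<Rightarrow> form. range \<Phi> \<subseteq> Form_QL \<and> Thm_RL_star {\<phi>} = Thm_RL_star (range \<Phi>)"
proof -
  have "\<forall>n. \<exists>\<beta>. \<beta> \<in> Form_QL \<and> (\<forall>e\<in>assignments.
      term_fun \<phi> e \<le> term_fun \<beta> e \<and> term_fun \<beta> e \<le> term_fun \<phi> e + inverse (real (Suc n)))"
    using rational_squeeze[OF inverse_Suc, of \<phi>] by meson
  from choice[OF this] obtain \<Phi> where rat: "\<And>n. \<Phi> n \<in> Form_QL"
    and above: "\<And>n e. e \<in> assignments \<Longrightarrow> term_fun \<phi> e \<le> term_fun (\<Phi> n) e"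
    and close: "\<And>n e. e \<in> assignments \<Longrightarrow>
      term_fun (\<Phi> n) e \<le> term_fun \<phi> e + inverse (real (Suc n))"
    by blast
  have "form_lim \<Phi> \<phi>"
    unfolding form_lim_def
  proof (rule uniform_limitI)
    fix \<epsilon> :: real
    assume "\<epsilon> > 0"
    then have "\<forall>\<^sub>F n in sequentially. inverse (real (Suc n)) < \<epsilon>"
      using LIMSEQ_inverse_real_of_nat by (rule order_tendstoD(2)[rotated])
    then show "\<forall>\<^sub>F n in sequentially. \<forall>e\<in>assignments. dist (term_fun (\<Phi> n) e) (term_fun \<phi> e) < \<epsilon>"
    proof eventually_elim
      case (elim n)
      show ?case
      proof
        fix e assume "e \<in> assignments"
        from above[OF this, of n] close[OF this, of n] elim
        show "dist (term_fun (\<Phi> n) e) (term_fun \<phi> e) < \<epsilon>"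
          unfolding dist_real_def by linarith
      qed
    qed
  qed
  then have "\<phi> \<in> Thm_RL_star (range \<Phi>)"
    by (rule Thm_RL_star.star) (simp add: Thm_RL_star.hyp)
  moreover have "\<Phi> n \<in> Thm_RL_star {\<phi>}" for n
  proof (rule Thm_RL_star.mp)
    show "\<phi> \<in> Thm_RL_star {\<phi>}" by (simp add: Thm_RL_star.hyp)
    show "Imp \<phi> (\<Phi> n) \<in> Thm_RL_star {\<phi>}"
      using above[of _ n] by (intro tautology_in_Thm) simp
  qed
  \<comment> \<open>By closure under derivation it suffices that each side derives the generators of
    the other.\<close>
  ultimately have "Thm_RL_star {\<phi>} = Thm_RL_star (range \<Phi>)"
    by (intro equalityI Thm_closed) auto
  with rat show ?thesis by blast
qed

end
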